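(* For any positive integers $k,l,m\geqslant 1$, there exists a constant $c'=c'(k,l,m)$ such that every balanced $S_{k,l}$-free bipartite graph with minimum degree at least $c'$ contains an $m$-factor. In particular, $c'=2(\max\{k,l,m\})^2$ will do.
   Context: All graphs are simple (no loops or multiple edges). For positive integers $k,l$, $S_{k,l}$ is the graph obtained from disjoint stars $K_{1,k}$ and $K_{1,l}$ by adding an edge between the $k$-degree vertex in $K_{1,k}$ and the $l$-degree vertex in $K_{1,l}$ (when $k=1$ or $l=1$, either vertex of $K_{1,1}$ may be used, with the same resulting graph up to isomorphism). A graph is $F$-free if it contains no induced subgraph isomorphic to $F$. A bipartite graph $G=(X,Y;E)$ with bipartition $(X,Y)$ is balanced if its two partite sets have the same cardinality, i.e., $|X|=|Y|$. An $m$-factor of a graph is an $m$-regular spanning subgraph of the graph (not necessarily connected).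
   Formalization: "Balanced" is taken to mean that every bipartition of G has classes of equal size (every component is balanced); with |X|=|Y| for just one bipartition the claim fails for the disjoint union of K_{c,c+1} and K_{c+1,c}. *)

theory Defs
  imports "Graph_Theory.Graph_Theory"
begin

text \<open>
  Finite simple graphs are the \<^locale>\<open>pair_graph\<close>s of the imported graph library: an edge
  $uv$ is represented by the two arcs $(u,v)$ and $(v,u)$. Hence the degree of $v$ is the number of
  arcs leaving $v$.
\<close>

abbreviation degree :: "'a pair_pre_digraph \<Rightarrow> 'a \<Rightarrow> nat" where
  "degree G v \<equiv> out_degree (with_proj G) v"

text \<open>
  Unspecified for the graph without vertices; as that graph is its own factor of every degree,
  the value does not matter for the existence of factors.
\<close>

definition min_degree :: "'a pair_pre_digraph \<Rightarrow> nat" where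
  "min_degree G = Min (degree G ` pverts G)"

definition bipartition :: "'a pair_pre_digraph \<Rightarrow> 'a set \<Rightarrow> 'a set \<Rightarrow> bool" where
  "bipartition G X Y \<longleftrightarrow>
     pverts G = X \<union> Y \<and> X \<inter> Y = {} \<and> parcs G \<subseteq> X \<times> Y \<union> Y \<times> X"

definition bipartite :: "'a pair_pre_digraph \<Rightarrow> bool" where
  "bipartite G \<longleftrightarrow> (\<exists>X Y. bipartition G X Y)"

text \<open>
  The bipartition of a disconnected graph is not unique, so balancedness must not depend on the one
  chosen: all of them are required to have classes of equal size. Asking for a single such
  bipartition would admit the disjoint union of $K_{c,c+1}$ and $K_{c+1,c}$, which contains no
  induced path on four vertices, has minimum degree $c$ and has no $m$-factor for any $m \ge 1$.
  For connected graphs there is no difference, see \<open>balanced_iff_connected\<close> below.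
\<close>

definition balanced :: "'a pair_pre_digraph \<Rightarrow> bool" where
  "balanced G \<longleftrightarrow> (\<forall>X Y. bipartition G X Y \<longrightarrow> card X = card Y)"

definition induced_free :: "'b pair_pre_digraph \<Rightarrow> 'a pair_pre_digraph \<Rightarrow> bool" where
  "induced_free F G \<longleftrightarrow>
     \<not> (\<exists>H. induced_subgraph H (with_proj G) \<and> digraph_iso H (with_proj F))"

text \<open>The star $K_{1,k}$ with centre 0 and leaves $1,\dots,k$.\<close>

definition star :: "nat \<Rightarrow> nat pair_pre_digraph" where
  "star k = \<lparr> pverts = {0..k}, parcs = {0} \<times> {1..k} \<union> {1..k} \<times> {0} \<rparr>"

text \<open>$S_{k,l}$: the disjoint union of two stars, with an edge joining their centres.\<close>

definition double_star :: "nat \<Rightarrow> nat \<Rightarrow> (nat + nat) pair_pre_digraph" where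
  "double_star k l =
     \<lparr> pverts = pverts (star k) <+> pverts (star l),
       parcs = map_prod Inl Inl ` parcs (star k) \<union> map_prod Inr Inr ` parcs (star l)
               \<union> {(Inl 0, Inr 0), (Inr 0, Inl 0)} \<rparr>"

text \<open>
  \<^const>\<open>spanning\<close> only gives a subdigraph on all vertices; that a factor is again an undirected
  graph has to be required separately.
\<close>

definition is_factor :: "nat \<Rightarrow> 'a pair_pre_digraph \<Rightarrow> 'a pair_pre_digraph \<Rightarrow> bool" where
  "is_factor m H G \<longleftrightarrow>
     pair_graph H \<and> spanning (with_proj H) (with_proj G) \<and> (\<forall>v\<in>pverts H. degree H v = m)"

lemma star_complete_bipartite: "K\<^bsub>1,k\<^esub> (with_proj (star k))"
  unfolding complete_bipartite_digraph_pair_def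
proof (intro conjI exI)
  show "pverts (star k) = {0} \<union> {1..k}" "{0} \<inter> {1..k} = {}" "card {0::nat} = 1" "card {1..k} = k"
    "parcs (star k) = {0} \<times> {1..k} \<union> {1..k} \<times> {0}"
    by (auto simp: star_def)
qed (simp add: star_def)

lemma pair_graph_double_star: "pair_graph (double_star k l)"
proof
  show "symmetric (with_proj (double_star k l))"
    by (auto simp: symmetric_def sym_def double_star_def star_def map_prod_def image_Un image_paired_Times)
qed (auto simp: double_star_def star_def)

lemma bipartition_connected_unique:
  assumes "pair_graph G" and conn: "connected (with_proj G)"
    and XY: "bipartition G X Y" and AB: "bipartition G A B"
  shows "A = X \<and> B = Y \<or> A = Y \<and> B = X"
proof -
  interpret pair_graph G by fact
  have ends: "parcs (mk_symmetric (with_proj G)) = parcs G"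
    using arcs_symmetric by (auto simp: mk_symmetric_def)
  have step: "(u \<in> X \<longleftrightarrow> u \<in> A) \<longleftrightarrow> (v \<in> X \<longleftrightarrow> v \<in> A)" if "(u, v) \<in> parcs G" for u v
  proof -
    have "u \<in> X \<longleftrightarrow> v \<notin> X" "u \<in> A \<longleftrightarrow> v \<notin> A"
      using that XY AB by (auto simp: bipartition_def)
    then show ?thesis by blast
  qed
  have same: "(u \<in> X \<longleftrightarrow> u \<in> A) \<longleftrightarrow> (v \<in> X \<longleftrightarrow> v \<in> A)"
    if "u \<in> pverts G" "v \<in> pverts G" for u v
  proof -
    have "(u, v) \<in> rtrancl_on (pverts G) (parcs G)"
      using conn that ends
      by (auto simp: connected_def strongly_connected_def reachable_def mk_symmetric_def)
    then show ?thesis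
    proof (induction rule: rtrancl_on.induct)
      case (rtrancl_on_into_rtrancl_on a b c)
      then show ?case using step[of b c] by simp
    qed simp
  qed
  show ?thesis
  proof (cases "\<forall>v\<in>pverts G. v \<in> X \<longleftrightarrow> v \<in> A")
    case True
    then have "A = X" "B = Y" using XY AB by (auto simp: bipartition_def)
    then show ?thesis by simp
  next
    case False
    then have "\<forall>v\<in>pverts G. \<not> (v \<in> X \<longleftrightarrow> v \<in> A)" using same by metis
    then have "A = Y" "B = X" using XY AB by (auto simp: bipartition_def)
    then show ?thesis by simp
  qed
qed

lemma balanced_iff_connected:
  assumes "pair_graph G" "connected (with_proj G)" "bipartition G X Y"
  shows "balanced G \<longleftrightarrow> card X = card Y"
  using bipartition_connected_unique[OF assms] assms(3) unfolding balanced_def by metis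

end

theory Submission
  imports Defs
begin

text \<open>
  Put $t = \max\{k,l,m\}$. If there is no $m$-factor, the degree-constrained form of Hall's condition
  fails: $m|S| > m|T| + e(S, Y \setminus T)$ for some $S \subseteq X$, $T \subseteq Y$, and the same then
  holds with $t$ in place of $m$. Choose the violation extremal and put $S' = X \setminus S$,
  $R = Y \setminus T$. Extremality makes every vertex of $S$ (of $R$) have fewer than $t$ neighbours in
  $R$ (in $S$) and every vertex of $S'$ at least $t$ neighbours in $R$.

  $S_{k,l}$-freeness is used in one form: if there is no edge between $P$ and $Q$, then no edge $xy$
  has $t$ neighbours of $x$ in $Q$ and $t$ neighbours of $y$ in $P$. It shows that the vertices $T_1$ of
  $T$ with a neighbour in $S'$ have fewer than $t^2$ neighbours in $S$, whereas the vertices $S_1$ of $S$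
  with a neighbour in $T_1$ have at least $t^2$ neighbours in $T_1$; hence $|S_1| \le |T_1|$. From the
  remaining pair $(P, Q)$ one peels off in the same way the vertices of $Q$ with a neighbour in
  $S \setminus P$ together with their neighbours in $P$, never removing more from $P$ than from $Q$.
  When this stops, $P \cup Q$ is a union of components, so $|P| = |Q|$ by balancedness. Altogether
  $|S| \le |T|$, which contradicts the violation.
\<close>

section \<open>Degree-constrained subgraphs of bipartite graphs\<close>

text \<open>Holds edge by edge: an edge counted twice on the left has one end in
  \<open>S1 \<inter> S2\<close> and the other outside \<open>T1 \<union> T2\<close>, hence is
  counted twice on the right; an edge counted once on the left is counted at least once on the
  right.\<close>

lemma card_cut_submodular:
  assumes "finite E"
  shows "card (E \<inter> (S1 \<inter> S2) \<times> - (T1 \<inter> T2)) + card (E \<inter> (S1 \<union> S2) \<times> - (T1 \<union> T2))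
    \<le> card (E \<inter> S1 \<times> - T1) + card (E \<inter> S2 \<times> - T2)"
proof -
  have card: "card (E \<inter> A) = (\<Sum>e\<in>E. of_bool (e \<in> A))" for A
    using assms by (simp add: sum.If_cases flip: if_distrib)
  show ?thesis
    unfolding card sum.distrib[symmetric] by (rule sum_mono) auto
qed

text \<open>
  Induction on the edges: an edge can be deleted, or put into \<open>F\<close> lowering both bounds by one.
  If both break the condition, two tight sets contradict submodularity of the cut function. The
  bounds are integers because this lowering may make them negative.
\<close>

lemma ex_subset_degree_bounds:
  fixes f :: "'a \<Rightarrow> int" and g :: "'b \<Rightarrow> int"
  assumes "finite E" "finite X" "finite Y" "E \<subseteq> X \<times> Y"
    and "\<And>S T. S \<subseteq> X \<Longrightarrow> T \<subseteq> Y \<Longrightarrow> sum f S \<le> sum g T + int (card (E \<inter> S \<times> - T))"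
  shows "\<exists>F\<subseteq>E. (\<forall>x\<in>X. f x \<le> int (card (F `` {x}))) \<and> (\<forall>y\<in>Y. int (card (F\<inverse> `` {y})) \<le> g y)"
  using assms
proof (induction E arbitrary: f g)
  case empty
  have "f x \<le> 0" if "x \<in> X" for x using empty.prems(4)[of "{x}" "{}"] that by simp
  moreover have "0 \<le> g y" if "y \<in> Y" for y using empty.prems(4)[of "{}" "{y}"] that by simp
  ultimately show ?case by auto
next
  case (insert e E)
  obtain x y where e: "e = (x, y)" by fastforce
  have xy: "x \<in> X" "y \<in> Y" and EXY: "E \<subseteq> X \<times> Y" using insert.prems(3) e by auto
  define f' where "f' = f(x := f x - 1)"
  define g' where "g' = g(y := g y - 1)"
  have fin: "finite S" "finite T" if "S \<subseteq> X" "T \<subseteq> Y" for S T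
    using that insert.prems(1,2) finite_subset by auto
  have f': "sum f' S = sum f S - of_bool (x \<in> S)" if "S \<subseteq> X" for S
  proof -
    have "sum f' S = (\<Sum>a\<in>S. f a - of_bool (a = x))" by (rule sum.cong) (auto simp: f'_def)
    then show ?thesis using fin[OF that, of "{}"] by (simp add: sum_subtractf)
  qed
  have g': "sum g' T = sum g T - of_bool (y \<in> T)" if "T \<subseteq> Y" for T
  proof -
    have "sum g' T = (\<Sum>a\<in>T. g a - of_bool (a = y))" by (rule sum.cong) (auto simp: g'_def)
    then show ?thesis using fin[OF _ that, of "{}"] by (simp add: sum_subtractf)
  qed
  have cut: "card (insert e E \<inter> S \<times> - T) = card (E \<inter> S \<times> - T) + of_bool (x \<in> S \<and> y \<notin> T)" for S T
    using insert.hyps e by (auto simp: Int_insert_left)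
  note cond = insert.prems(4)[unfolded cut]
  \<comment> \<open>The cut condition for \<open>E\<close> alone, that is, without \<open>e\<close>,
    as a predicate of the bounds: \<open>C f g\<close> permits deleting \<open>e\<close>,
    \<open>C f' g'\<close> permits putting \<open>e\<close> into the subset.\<close>
  define C where "C f g \<longleftrightarrow> (\<forall>S\<subseteq>X. \<forall>T\<subseteq>Y. sum f S \<le> sum g T + int (card (E \<inter> S \<times> - T)))"
    for f g
  consider (delete) "C f g" | (force) "C f' g'" | (contr) "\<not> C f g" "\<not> C f' g'" by blast
  then show ?case
  proof cases
    case delete
    then show ?thesis using insert.IH[OF insert.prems(1,2) EXY, of f g] by (auto simp: C_def)
  next
    case force
    obtain F where F: "F \<subseteq> E" "\<forall>x\<in>X. f' x \<le> int (card (F `` {x}))"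
      "\<forall>y\<in>Y. int (card (F\<inverse> `` {y})) \<le> g' y"
      using insert.IH[OF insert.prems(1,2) EXY, of f' g'] force unfolding C_def by blast
    have "finite F" "(x, y) \<notin> F" using F(1) insert.hyps e finite_subset by auto
    have "finite (F `` {x})" "finite (F\<inverse> `` {y})" using \<open>finite F\<close> by auto
    moreover have "insert e F `` {a} = (if a = x then insert y (F `` {x}) else F `` {a})" for a
      using e by auto
    moreover have "(insert e F)\<inverse> `` {b} = (if b = y then insert x (F\<inverse> `` {y}) else F\<inverse> `` {b})" for b
      using e by auto
    ultimately have
      "card (insert e F `` {a}) = card (F `` {a}) + of_bool (a = x)"
      "card ((insert e F)\<inverse> `` {b}) = card (F\<inverse> `` {b}) + of_bool (b = y)" for a b
      using \<open>(x, y) \<notin> F\<close> by auto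
    then show ?thesis using F unfolding f'_def g'_def
      by (intro exI[of _ "insert e F"]) (fastforce split: if_splits)
  next
    case contr
    obtain S1 T1 where 1: "S1 \<subseteq> X" "T1 \<subseteq> Y" "sum f S1 > sum g T1 + int (card (E \<inter> S1 \<times> - T1))"
      using contr(1) unfolding C_def by (auto simp: not_le)
    obtain S2 T2 where 2: "S2 \<subseteq> X" "T2 \<subseteq> Y" "sum f' S2 > sum g' T2 + int (card (E \<inter> S2 \<times> - T2))"
      using contr(2) unfolding C_def by (auto simp: not_le)
    note tight = 1 2
    \<comment> \<open>The condition holds with \<open>e\<close> and fails without it, so
      \<open>e\<close> must cross the first cut, and the deficit is one. For the lowered bounds a
      violation is possible only if \<open>y\<close> alone is in the pair, which makes the second
      cut tight.\<close>
    have 1: "x \<in> S1 \<and> y \<notin> T1" "sum f S1 \<ge> sum g T1 + int (card (E \<inter> S1 \<times> - T1)) + 1"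
      using cond[OF tight(1,2)] tight(3) by (auto split: if_splits simp: of_bool_def)
    have 2: "x \<notin> S2 \<and> y \<in> T2" "sum f S2 \<ge> sum g T2 + int (card (E \<inter> S2 \<times> - T2))"
      using cond[OF tight(4,5)] tight(6) f'[OF tight(4)] g'[OF tight(5)]
      by (auto split: if_splits simp: of_bool_def)
    \<comment> \<open>As \<open>x \<notin> S2\<close> and \<open>y \<in> T2\<close>, the edge
      \<open>e\<close> crosses neither the cut of the intersections nor that of the unions. Adding
      the two bounds, the surplus 1 of the first cut contradicts submodularity.\<close>
    have "sum f (S1 \<inter> S2) \<le> sum g (T1 \<inter> T2) + int (card (E \<inter> (S1 \<inter> S2) \<times> - (T1 \<inter> T2)))"
      using cond[of "S1 \<inter> S2" "T1 \<inter> T2"] tight 2 by auto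
    moreover have "sum f (S1 \<union> S2) \<le> sum g (T1 \<union> T2) + int (card (E \<inter> (S1 \<union> S2) \<times> - (T1 \<union> T2)))"
      using cond[of "S1 \<union> S2" "T1 \<union> T2"] tight 2 by auto
    moreover have "sum f (S1 \<union> S2) + sum f (S1 \<inter> S2) = sum f S1 + sum f S2"
      "sum g (T1 \<union> T2) + sum g (T1 \<inter> T2) = sum g T1 + sum g T2"
      using fin tight by (auto intro!: sum.union_inter)
    ultimately show ?thesis
      using card_cut_submodular[OF \<open>finite E\<close>, of S1 S2 T1 T2] 1 2 by linarith
  qed
qed

lemma sum_card_Image:
  assumes "finite E" "finite P"
  shows "(\<Sum>x\<in>P. card (E `` {x} \<inter> Q)) = card (E \<inter> P \<times> Q)"
proof -
  have "E \<inter> P \<times> Q = (SIGMA x:P. E `` {x} \<inter> Q)" by auto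
  then show ?thesis using assms by (simp add: card_SigmaI)
qed

lemma sum_card_converse_Image:
  assumes "finite E" "finite Q"
  shows "(\<Sum>y\<in>Q. card (E\<inverse> `` {y} \<inter> P)) = card (E \<inter> P \<times> Q)"
proof -
  have "card (E\<inverse> \<inter> Q \<times> P) = card ((E \<inter> P \<times> Q)\<inverse>)" by (rule arg_cong[of _ _ card]) auto
  then show ?thesis using sum_card_Image[of "E\<inverse>" Q P] assms by simp
qed

text \<open>Degrees at least \<open>m\<close> on \<open>X\<close> and at most \<open>m\<close> on
  \<open>Y\<close> suffice: both degree sums count \<open>F\<close>, and
  \<open>card X = card Y\<close> forces equality at every vertex.\<close>

lemma ex_regular_subset:
  assumes "finite X" "finite Y" "E \<subseteq> X \<times> Y" "card X = card Y"
    and cond: "\<And>S T. S \<subseteq> X \<Longrightarrow> T \<subseteq> Y \<Longrightarrow> m * card S \<le> m * card T + card (E \<inter> S \<times> (Y - T))"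
  shows "\<exists>F\<subseteq>E. (\<forall>x\<in>X. card (F `` {x}) = m) \<and> (\<forall>y\<in>Y. card (F\<inverse> `` {y}) = m)"
proof -
  have "finite E" using assms finite_subset by blast
  have "\<exists>F\<subseteq>E. (\<forall>x\<in>X. int m \<le> int (card (F `` {x}))) \<and> (\<forall>y\<in>Y. int (card (F\<inverse> `` {y})) \<le> int m)"
  proof (rule ex_subset_degree_bounds)
    fix S T assume "S \<subseteq> X" "T \<subseteq> Y"
    have "E \<inter> S \<times> - T = E \<inter> S \<times> (Y - T)" using assms(3) by auto
    then have "int (m * card S) \<le> int (m * card T + card (E \<inter> S \<times> - T))"
      using cond[OF \<open>S \<subseteq> X\<close> \<open>T \<subseteq> Y\<close>] by (simp only: of_nat_le_iff)
    then show "(\<Sum>x\<in>S. int m) \<le> (\<Sum>y\<in>T. int m) + int (card (E \<inter> S \<times> - T))"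
      by (simp add: mult.commute)
  qed (use assms \<open>finite E\<close> in auto)
  then obtain F where F: "F \<subseteq> E" "\<forall>x\<in>X. m \<le> card (F `` {x})" "\<forall>y\<in>Y. card (F\<inverse> `` {y}) \<le> m"
    by auto
  have "finite F" using F \<open>finite E\<close> finite_subset by blast
  have "F `` {x} \<inter> Y = F `` {x}" "F\<inverse> `` {y} \<inter> X = F\<inverse> `` {y}" for x y using F(1) assms(3) by auto
  then have eq: "(\<Sum>x\<in>X. card (F `` {x})) = (\<Sum>y\<in>Y. card (F\<inverse> `` {y}))"
    using sum_card_Image[OF \<open>finite F\<close> assms(1), of Y]
      sum_card_converse_Image[OF \<open>finite F\<close> assms(2), of X] by simp
  have "(\<Sum>x\<in>X. card (F `` {x})) \<ge> (\<Sum>x\<in>X. m)" by (rule sum_mono) (use F in auto)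
  moreover have "(\<Sum>y\<in>Y. card (F\<inverse> `` {y})) \<le> (\<Sum>x\<in>Y. m)" by (rule sum_mono) (use F in auto)
  ultimately have sums: "(\<Sum>x\<in>X. m) = (\<Sum>x\<in>X. card (F `` {x}))" "(\<Sum>y\<in>Y. card (F\<inverse> `` {y})) = (\<Sum>x\<in>Y. m)"
    using eq assms(4) by auto
  have "m = card (F `` {x})" if "x \<in> X" for x
    by (rule sum_mono_inv[OF sums(1)]) (use F that assms in auto)
  moreover have "card (F\<inverse> `` {y}) = m" if "y \<in> Y" for y
    by (rule sum_mono_inv[OF sums(2)]) (use F that assms in auto)
  ultimately show ?thesis using F(1) by (intro exI[of _ F]) auto
qed

text \<open>Double counting: the number of edges between \<open>P\<close> and \<open>Q\<close> is at
  least \<open>a * card P\<close> and at most \<open>b * card Q\<close>.\<close>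

lemma card_le_by_degrees:
  assumes "finite E" "finite P" "finite Q" "b \<le> a" "0 < a"
    and "\<And>x. x \<in> P \<Longrightarrow> a \<le> card (E `` {x} \<inter> Q)"
    and "\<And>y. y \<in> Q \<Longrightarrow> card (E\<inverse> `` {y} \<inter> P) \<le> b"
  shows "card P \<le> card Q"
proof -
  have "a * card P = (\<Sum>x\<in>P. a)" by simp
  also have "\<dots> \<le> (\<Sum>x\<in>P. card (E `` {x} \<inter> Q))" by (rule sum_mono) (use assms in auto)
  also have "\<dots> = (\<Sum>y\<in>Q. card (E\<inverse> `` {y} \<inter> P))"
    by (simp only: sum_card_Image sum_card_converse_Image assms)
  also have "\<dots> \<le> (\<Sum>y\<in>Q. b)" by (rule sum_mono) (use assms in auto)
  also have "\<dots> \<le> a * card Q" using assms by simp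
  finally show ?thesis using assms by simp
qed

lemma card_Int_cover_le:
  assumes "finite N" "N \<subseteq> A \<union> B"
  shows "card N \<le> card (N \<inter> A) + card (N \<inter> B)"
proof -
  have "N = (N \<inter> A) \<union> (N \<inter> B)" using assms by auto
  then show ?thesis by (metis card_Un_le)
qed

section \<open>Counting in dense bipartite graphs without induced double stars\<close>

text \<open>Each edge is stored once, as a pair from \<open>X\<close> to \<open>Y\<close>. In
  \<open>double_star_free\<close> the absence of edges between \<open>P\<close> and \<open>Q\<close>
  is what makes the double star induced. \<open>closed_balanced\<close> states balancedness of every
  union of components. The bound \<open>2 * t^2\<close> ensures that a neighbourhood with at most
  \<open>t^2\<close> vertices in one of two covering parts has at least \<open>t^2\<close> in the
  other.\<close>

locale dense_double_star_free =
  fixes E :: "('a \<times> 'b) set" and X :: "'a set" and Y :: "'b set" and t :: nat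
  assumes finite_X: "finite X" and finite_Y: "finite Y" and E_subset: "E \<subseteq> X \<times> Y"
    and t_pos: "1 \<le> t"
    and degree_X: "\<And>x. x \<in> X \<Longrightarrow> 2 * t^2 \<le> card (E `` {x})"
    and degree_Y: "\<And>y. y \<in> Y \<Longrightarrow> 2 * t^2 \<le> card (E\<inverse> `` {y})"
    and double_star_free: "\<And>x y P Q. (x, y) \<in> E \<Longrightarrow> E \<inter> P \<times> Q = {} \<Longrightarrow>
          t \<le> card (E `` {x} \<inter> Q) \<Longrightarrow> card (E\<inverse> `` {y} \<inter> P) < t"
    and closed_balanced: "\<And>P Q. P \<subseteq> X \<Longrightarrow> Q \<subseteq> Y \<Longrightarrow> E `` P \<subseteq> Q \<Longrightarrow> E\<inverse> `` Q \<subseteq> P \<Longrightarrow>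
          card P = card Q"
begin

lemma finite_E: "finite E"
  using finite_X finite_Y E_subset finite_subset by blast

lemma finite_neighbours: "finite (E `` A)" "finite (E\<inverse> `` B)"
  using finite_E by auto

lemma t_le_square: "t \<le> t^2"
  using t_pos by (simp add: power2_eq_square)

lemma degree_X_split:
  assumes "x \<in> X" "E `` {x} \<subseteq> A \<union> B"
  shows "2 * t^2 \<le> card (E `` {x} \<inter> A) + card (E `` {x} \<inter> B)"
  using degree_X[OF assms(1)] card_Int_cover_le[OF finite_neighbours(1) assms(2)] by linarith

lemma degree_Y_split:
  assumes "y \<in> Y" "E\<inverse> `` {y} \<subseteq> A \<union> B"
  shows "2 * t^2 \<le> card (E\<inverse> `` {y} \<inter> A) + card (E\<inverse> `` {y} \<inter> B)"
  using degree_Y[OF assms(1)] card_Int_cover_le[OF finite_neighbours(2) assms(2)] by linarith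

text \<open>The pair \<open>(P, Q)\<close> is what remains of \<open>(S, T)\<close>. The invariants
  are that \<open>P\<close> has neighbours only in \<open>Q\<close>, that \<open>Q\<close> has
  neighbours only in \<open>S\<close>, that no more has been removed from \<open>S\<close> than from
  \<open>T\<close>, and that each removed vertex of \<open>S\<close> has \<open>t\<close> removed
  neighbours.\<close>

lemma card_le_by_peeling:
  assumes "P \<subseteq> S" "S \<subseteq> X" "Q \<subseteq> T" "T \<subseteq> Y"
    and "E `` P \<subseteq> Q" "E\<inverse> `` Q \<subseteq> S" "card (S - P) \<le> card (T - Q)"
    and "\<And>x. x \<in> S - P \<Longrightarrow> t \<le> card (E `` {x} \<inter> (T - Q))"
  shows "card S \<le> card T"
  using assms
proof (induction "card Q" arbitrary: P Q rule: less_induct)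
  case less
  have fin: "finite S" "finite T" using less.prems finite_X finite_Y finite_subset by blast+
  then have finPQ: "finite P" "finite Q" using less.prems finite_subset by blast+
  define Q1 where "Q1 = {y \<in> Q. E\<inverse> `` {y} \<inter> (S - P) \<noteq> {}}"
  define P1 where "P1 = {x \<in> P. E `` {x} \<inter> Q1 \<noteq> {}}"
  have sub: "P1 \<subseteq> P" "Q1 \<subseteq> Q" unfolding P1_def Q1_def by auto
  show ?case
  proof (cases "Q1 = {}")
    case True
    have "E\<inverse> `` Q \<subseteq> P" using True less.prems(6) unfolding Q1_def by fastforce
    then have "card P = card Q" using closed_balanced[of P Q] less.prems by blast
    moreover have "card S = card (S - P) + card P" "card T = card (T - Q) + card Q"
      using less.prems fin finPQ by (simp_all add: card_Diff_subset card_mono)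
    ultimately show ?thesis using less.prems(7) by linarith
  next
    case False
    have Q1_deg: "card (E\<inverse> `` {y} \<inter> P) \<le> t - 1" if y: "y \<in> Q1" for y
    proof -
      obtain x where x: "x \<in> S - P" "(x, y) \<in> E" using y unfolding Q1_def by auto
      \<comment> \<open>The removed neighbour \<open>x\<close> of \<open>y\<close> has
        \<open>t\<close> neighbours in \<open>T - Q\<close>, to which \<open>P\<close> sends no
        edge.\<close>
      have "card (E\<inverse> `` {y} \<inter> P) < t"
        by (rule double_star_free[OF x(2) _ less.prems(8)[OF x(1)]]) (use less.prems(5) in auto)
      then show ?thesis by simp
    qed
    have P1_deg: "t \<le> card (E `` {x} \<inter> Q1)" if x: "x \<in> P1" for x
    proof -
      obtain y where y: "y \<in> Q1" "(x, y) \<in> E" using x unfolding P1_def by auto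
      have "x \<in> X" "y \<in> Y" using y E_subset by auto
      have "E\<inverse> `` {y} \<subseteq> P \<union> (S - P)" using y(1) sub less.prems(6) by auto
      \<comment> \<open>Most neighbours of \<open>y\<close> were removed earlier, and by the choice
        of \<open>Q1\<close> none of them is adjacent to \<open>Q - Q1\<close>. The contrapositive
        of \<open>double_star_free\<close> then leaves \<open>x\<close> few neighbours in
        \<open>Q - Q1\<close>, so most are in \<open>Q1\<close>.\<close>
      then have "t \<le> card (E\<inverse> `` {y} \<inter> (S - P))"
        using degree_Y_split[OF \<open>y \<in> Y\<close>, of P "S - P"] Q1_deg[OF y(1)] t_le_square t_pos by linarith
      moreover have "E \<inter> (S - P) \<times> (Q - Q1) = {}" unfolding Q1_def by auto
      ultimately have "card (E `` {x} \<inter> (Q - Q1)) < t"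
        using double_star_free[OF y(2)] by (meson not_le)
      moreover have "E `` {x} \<subseteq> Q1 \<union> (Q - Q1)" using x sub less.prems(5) by auto
      ultimately show ?thesis
        using degree_X_split[OF \<open>x \<in> X\<close>, of Q1 "Q - Q1"] t_le_square by linarith
    qed
    have fin1: "finite P1" "finite Q1" using sub finPQ finite_subset by blast+
    have "card P1 \<le> card Q1"
    proof (rule card_le_by_degrees[of E P1 Q1 t t])
      fix y assume "y \<in> Q1"
      have "card (E\<inverse> `` {y} \<inter> P1) \<le> card (E\<inverse> `` {y} \<inter> P)"
        using sub finPQ by (intro card_mono) auto
      then show "card (E\<inverse> `` {y} \<inter> P1) \<le> t"
        using Q1_deg[OF \<open>y \<in> Q1\<close>] t_pos by linarith
    qed (use finite_E fin1 P1_deg t_pos in auto)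
    have SP: "S - (P - P1) = (S - P) \<union> P1" "T - (Q - Q1) = (T - Q) \<union> Q1"
      using sub less.prems by auto
    show ?thesis
    proof (rule less.hyps[of "Q - Q1" "P - P1"])
      show "card (Q - Q1) < card Q" using False sub finPQ by (intro psubset_card_mono) auto
      show "E `` (P - P1) \<subseteq> Q - Q1" using less.prems(5) unfolding P1_def by auto
      have "card ((S - P) \<union> P1) \<le> card (S - P) + card P1" by (rule card_Un_le)
      also have "\<dots> \<le> card (T - Q) + card Q1"
        using less.prems(7) \<open>card P1 \<le> card Q1\<close> by simp
      also have "\<dots> = card ((T - Q) \<union> Q1)"
        using fin fin1 sub by (subst card_Un_disjoint) auto
      finally show "card (S - (P - P1)) \<le> card (T - (Q - Q1))" unfolding SP .
      fix x assume "x \<in> S - (P - P1)"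
      then have "t \<le> card (E `` {x} \<inter> (T - Q)) \<or> t \<le> card (E `` {x} \<inter> Q1)"
        using less.prems(8) P1_deg by auto
      moreover have "card (E `` {x} \<inter> (T - Q)) \<le> card (E `` {x} \<inter> ((T - Q) \<union> Q1))"
        "card (E `` {x} \<inter> Q1) \<le> card (E `` {x} \<inter> ((T - Q) \<union> Q1))"
        using finite_neighbours by (auto intro!: card_mono)
      ultimately show "t \<le> card (E `` {x} \<inter> (T - (Q - Q1)))" unfolding SP by linarith
    qed (use less.prems in auto)
  qed
qed

text \<open>Removing \<open>S1\<close> and \<open>T1\<close> establishes the invariants of
  \<open>card_le_by_peeling\<close>. This first round needs its own estimate: vertices of
  \<open>T1\<close> are only known to have fewer than \<open>t^2\<close> neighbours in
  \<open>S\<close>, which is matched by \<open>t^2\<close> neighbours in \<open>T1\<close> for each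
  vertex of \<open>S1\<close>.\<close>

lemma card_le_of_sparse_cut:
  assumes "S \<subseteq> X" "T \<subseteq> Y"
    and S_deg: "\<And>x. x \<in> S \<Longrightarrow> card (E `` {x} \<inter> (Y - T)) < t"
    and R_deg: "\<And>y. y \<in> Y - T \<Longrightarrow> card (E\<inverse> `` {y} \<inter> S) < t"
    and S'_deg: "\<And>x. x \<in> X - S \<Longrightarrow> t \<le> card (E `` {x} \<inter> (Y - T))"
  shows "card S \<le> card T"
proof -
  have fin: "finite S" "finite T" using assms finite_X finite_Y finite_subset by blast+
  define T1 where "T1 = {y \<in> T. E\<inverse> `` {y} \<inter> (X - S) \<noteq> {}}"
  define S1 where "S1 = {x \<in> S. E `` {x} \<inter> T1 \<noteq> {}}"
  have sub: "S1 \<subseteq> S" "T1 \<subseteq> T" unfolding S1_def T1_def by auto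
  have no_edge: "E \<inter> (X - S) \<times> (T - T1) = {}" unfolding T1_def by auto
  have T1_deg: "card (E\<inverse> `` {y} \<inter> S) < t^2" if y: "y \<in> T1" for y
  proof (rule ccontr)
    assume large: "\<not> ?thesis"
    obtain x where x: "x \<in> X - S" "(x, y) \<in> E" using y unfolding T1_def by auto
    obtain A where A: "A \<subseteq> E `` {x} \<inter> (Y - T)" "card A = t" "finite A"
      using S'_deg[OF x(1)] by (metis obtain_subset_with_card_n)
    \<comment> \<open>Each of the \<open>t\<close> vertices of \<open>A\<close> has at most
      \<open>t - 1\<close> neighbours in \<open>S\<close>, so \<open>B\<close> has at most
      \<open>t * (t - 1)\<close> elements. Of \<open>t^2\<close> neighbours of \<open>y\<close> in
      \<open>S\<close>, at least \<open>t\<close> avoid \<open>B\<close> and have no edge to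
      \<open>A\<close>; with \<open>A\<close> they form a forbidden double star around
      \<open>(x, y)\<close>.\<close>
    define B where "B = (\<Union>a\<in>A. E\<inverse> `` {a} \<inter> S)"
    have "card B \<le> (\<Sum>a\<in>A. card (E\<inverse> `` {a} \<inter> S))" unfolding B_def by (rule card_UN_le[OF A(3)])
    also have "\<dots> \<le> (\<Sum>a\<in>A. t - 1)" by (rule sum_mono) (use A R_deg in fastforce)
    also have "\<dots> = t * (t - 1)" using A by simp
    finally have "card B \<le> t * (t - 1)" .
    moreover have "card (E\<inverse> `` {y} \<inter> S) \<le>
        card (E\<inverse> `` {y} \<inter> S \<inter> (S - B)) + card (E\<inverse> `` {y} \<inter> S \<inter> B)"
      by (rule card_Int_cover_le) (use fin in auto)
    moreover have "card (E\<inverse> `` {y} \<inter> S \<inter> B) \<le> card B"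
      by (rule card_mono) (auto simp: B_def A(3) fin)
    moreover have "t^2 = t * (t - 1) + t" using t_pos by (cases t) (auto simp: power2_eq_square)
    ultimately have "t \<le> card (E\<inverse> `` {y} \<inter> S \<inter> (S - B))" using large by linarith
    moreover have "E\<inverse> `` {y} \<inter> S \<inter> (S - B) = E\<inverse> `` {y} \<inter> (S - B)" by auto
    moreover have "E `` {x} \<inter> A = A" using A by auto
    moreover have "E \<inter> (S - B) \<times> A = {}" unfolding B_def by auto
    ultimately show False using double_star_free[OF x(2), of "S - B" A] A(2) by simp
  qed
  have S1_deg: "t^2 \<le> card (E `` {x} \<inter> T1)" if x: "x \<in> S1" for x
  proof -
    obtain y where y: "y \<in> T1" "(x, y) \<in> E" using x unfolding S1_def by auto
    have "x \<in> X" "y \<in> Y" using y E_subset by auto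
    have "E\<inverse> `` {y} \<subseteq> S \<union> (X - S)" using E_subset by auto
    then have "t \<le> card (E\<inverse> `` {y} \<inter> (X - S))"
      using degree_Y_split[OF \<open>y \<in> Y\<close>, of S "X - S"] T1_deg[OF y(1)] t_le_square by linarith
    then have "card (E `` {x} \<inter> (T - T1)) < t"
      using double_star_free[OF y(2) no_edge] by (meson not_le)
    moreover have "card (E `` {x} \<inter> (Y - T)) < t" using x sub S_deg by auto
    moreover have "2 * t^2 \<le> card (E `` {x} \<inter> T1) + card (E `` {x} \<inter> ((T - T1) \<union> (Y - T)))"
      by (rule degree_X_split[OF \<open>x \<in> X\<close>]) (use E_subset in auto)
    moreover have "card (E `` {x} \<inter> ((T - T1) \<union> (Y - T))) \<le>
        card (E `` {x} \<inter> (T - T1)) + card (E `` {x} \<inter> (Y - T))"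
      by (metis Int_Un_distrib card_Un_le)
    \<comment> \<open>At most \<open>t - 1\<close> neighbours of \<open>x\<close> are in
      \<open>T - T1\<close> and at most \<open>t - 1\<close> in \<open>Y - T\<close>, so
      \<open>t^2\<close> of the \<open>2 * t^2\<close> remain for \<open>T1\<close>.\<close>
    moreover have "2 * (t - 1) \<le> t^2"
      using t_pos
      by (cases t) (auto simp: power2_eq_square algebra_simps)
    ultimately show ?thesis by linarith
  qed
  have fin1: "finite S1" "finite T1" using sub fin finite_subset by blast+
  have "card S1 \<le> card T1"
  proof (rule card_le_by_degrees[of E S1 T1 "t^2" "t^2"])
    fix y assume "y \<in> T1"
    have "card (E\<inverse> `` {y} \<inter> S1) \<le> card (E\<inverse> `` {y} \<inter> S)"
      using sub fin by (intro card_mono) auto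
    then show "card (E\<inverse> `` {y} \<inter> S1) \<le> t^2" using T1_deg[OF \<open>y \<in> T1\<close>] by linarith
  qed (use finite_E fin1 S1_deg t_pos in auto)
  have closed: "E `` (S - S1) \<subseteq> T - T1"
  proof
    fix y assume "y \<in> E `` (S - S1)"
    then obtain x where x: "x \<in> S" "x \<notin> S1" "(x, y) \<in> E" by auto
    then have "x \<in> X" "y \<in> Y" "y \<notin> T1" using E_subset unfolding S1_def by auto
    \<comment> \<open>Otherwise \<open>x\<close>, with no neighbour in \<open>T1\<close> and few
      outside \<open>T\<close>, has \<open>t\<close> neighbours in \<open>T - T1\<close>. Then
      \<open>y\<close> has fewer than \<open>t\<close> neighbours in \<open>X - S\<close> and fewer
      than \<open>t\<close> in \<open>S\<close>, too few for its degree.\<close>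
    have "y \<in> T"
    proof (rule ccontr)
      assume "y \<notin> T"
      have "E `` {x} \<subseteq> (Y - T) \<union> (T - T1)" using E_subset x unfolding S1_def by auto
      then have "t \<le> card (E `` {x} \<inter> (T - T1))"
        using degree_X_split[OF \<open>x \<in> X\<close>, of "Y - T" "T - T1"] S_deg[OF x(1)] t_le_square
        by linarith
      then have "card (E\<inverse> `` {y} \<inter> (X - S)) < t" by (rule double_star_free[OF x(3) no_edge])
      moreover have "E\<inverse> `` {y} \<subseteq> S \<union> (X - S)" using E_subset by auto
      moreover have "card (E\<inverse> `` {y} \<inter> S) < t" using R_deg \<open>y \<in> Y\<close> \<open>y \<notin> T\<close> by simp
      ultimately show False
        using degree_Y_split[OF \<open>y \<in> Y\<close>, of S "X - S"] t_le_square by linarith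
    qed
    then show "y \<in> T - T1" using \<open>y \<notin> T1\<close> by simp
  qed
  have compl: "S - (S - S1) = S1" "T - (T - T1) = T1" using sub by auto
  show ?thesis
  proof (rule card_le_by_peeling[of "S - S1" S "T - T1" T])
    show "E\<inverse> `` (T - T1) \<subseteq> S" using no_edge E_subset by auto
    show "card (S - (S - S1)) \<le> card (T - (T - T1))" unfolding compl by fact
    show "t \<le> card (E `` {x} \<inter> (T - (T - T1)))" if "x \<in> S - (S - S1)" for x
      using that S1_deg t_le_square unfolding compl by fastforce
  qed (use assms closed in auto)
qed

section \<open>The extremal violation of the factor condition\<close>

lemma factor_condition:
  assumes "m \<le> t" "S0 \<subseteq> X" "T0 \<subseteq> Y"
  shows "m * card S0 \<le> m * card T0 + card (E \<inter> S0 \<times> (Y - T0))"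
proof (rule ccontr)
  assume viol: "\<not> ?thesis"
  \<comment> \<open>The extremal choice maximises the excess \<open>t|S| - t|T| - e(S, R)\<close>, where \<open>R = Y - T\<close>, and breaks ties
      by minimising \<open>|S| + |R|\<close>; the factor \<open>K\<close> makes the excess dominate.\<close>
  define excess where "excess S R =
      int t * int (card S) + int t * int (card R) - int t * int (card Y) - int (card (E \<inter> S \<times> R))" for S R
  define K where "K = int (card X) + int (card Y) + 1"
  define w where "w p = (case p of (S, R) \<Rightarrow> K * excess S R - int (card S) - int (card R))" for p
  have "finite (w ` (Pow X \<times> Pow Y))" "w ` (Pow X \<times> Pow Y) \<noteq> {}" using finite_X finite_Y by auto
  then obtain p where p: "p \<in> Pow X \<times> Pow Y" "\<And>q. q \<in> Pow X \<times> Pow Y \<Longrightarrow> w q \<le> w p"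
    by (smt (verit, best) Max_in Max_ge imageE imageI)
  obtain S R where SR: "p = (S, R)" by fastforce
  have S: "S \<subseteq> X" and R: "R \<subseteq> Y" using p SR by auto
  have max: "w (S', R') \<le> w (S, R)" if "S' \<subseteq> X" "R' \<subseteq> Y" for S' R' using p SR that by auto
  have fin: "finite S" "finite R" using S R finite_X finite_Y finite_subset by blast+
  have cardY: "card (Y - T) + card T = card Y" if "T \<subseteq> Y" for T
    using that finite_Y by (metis card_Diff_subset card_mono finite_subset le_add_diff_inverse2)
  have "card T0 < card S0"
    using viol by (metis not_le mult_le_mono2 trans_le_add1)
  \<comment> \<open>Passing from \<open>m\<close> to \<open>t\<close> preserves the violation
    because \<open>card S0 - card T0\<close> is positive.\<close>
  have "excess S0 (Y - T0) \<ge> 1"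
  proof -
    obtain d where d: "card S0 = card T0 + d"
      using \<open>card T0 < card S0\<close> less_imp_add_positive by metis
    have "card (E \<inter> S0 \<times> (Y - T0)) < m * d" using viol d by (simp add: algebra_simps)
    also have "\<dots> \<le> t * d" using assms(1) by simp
    finally have "int (card (E \<inter> S0 \<times> (Y - T0))) < int t * int d" by (metis of_nat_less_iff of_nat_mult)
    moreover have "int (card S0) + int (card (Y - T0)) - int (card Y) = int d"
      using cardY[OF assms(3)] d by linarith
    then have "int t * int (card S0) + int t * int (card (Y - T0)) - int t * int (card Y) = int t * int d"
      by (metis distrib_left right_diff_distrib)
    ultimately show ?thesis unfolding excess_def by linarith
  qed
  then have "K * 1 \<le> K * excess S0 (Y - T0)" unfolding K_def by (intro mult_left_mono) auto
  moreover have "card S0 \<le> card X" "card (Y - T0) \<le> card Y"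
    using assms finite_X finite_Y by (auto intro: card_mono)
  moreover have "K * 1 = int (card X) + int (card Y) + 1" unfolding K_def by simp
  ultimately have "w (S0, Y - T0) > 0" unfolding w_def prod.case by linarith
  then have "w (S, R) > 0" using max[of S0 "Y - T0"] assms by auto
  then have "0 < K * excess S R" unfolding w_def by auto
  then have "0 < excess S R" unfolding K_def by (simp add: zero_less_mult_iff)
  then have "int t * int (card Y) < int t * (int (card S) + int (card R))"
    unfolding excess_def by (simp add: distrib_left)
  then have "card Y < card S + card R" by (simp add: mult_less_cancel_left)
  then have lt: "card (Y - R) < card S" using cardY[OF R] by linarith
  have e_Image: "card (E \<inter> S' \<times> R') = (\<Sum>x\<in>S'. card (E `` {x} \<inter> R'))" if "finite S'" for S' R'
    using sum_card_Image[OF finite_E that] by simp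
  have e_converse: "card (E \<inter> S' \<times> R') = (\<Sum>y\<in>R'. card (E\<inverse> `` {y} \<inter> S'))" if "finite R'" for S' R'
    using sum_card_converse_Image[OF finite_E that] by simp
  \<comment> \<open>The tie-break makes this strict: a smaller pair of equal excess would have
    larger \<open>w\<close>. Deleting a vertex changes the excess by its degree across the cut minus
    \<open>t\<close>, so that degree is below \<open>t\<close>.\<close>
  have worse: "excess S' R' < excess S R" if "S' \<subseteq> X" "R' \<subseteq> Y"
    "card S' + card R' < card S + card R" for S' R'
  proof (rule ccontr)
    assume "\<not> ?thesis"
    then have "K * excess S R \<le> K * excess S' R'" unfolding K_def by (intro mult_left_mono) auto
    then show False using max[OF that(1,2)] that(3) unfolding w_def by auto
  qed
  have "card S \<le> card (Y - R)"
  proof (rule card_le_of_sparse_cut)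
    have R': "Y - (Y - R) = R" using R by auto
    show "card (E `` {x} \<inter> (Y - (Y - R))) < t" if "x \<in> S" for x
    proof -
      have c: "card S = Suc (card (S - {x}))" using card.remove[OF fin(1) that] by simp
      have "card (E \<inter> S \<times> R) = card (E `` {x} \<inter> R) + card (E \<inter> (S - {x}) \<times> R)"
        using that fin by (simp add: e_Image sum.remove)
      then show ?thesis using worse[of "S - {x}" R] S R c unfolding R' excess_def
        by (auto simp: algebra_simps)
    qed
    show "card (E\<inverse> `` {y} \<inter> S) < t" if "y \<in> Y - (Y - R)" for y
    proof -
      have "y \<in> R" using that by auto
      have c: "card R = Suc (card (R - {y}))" using card.remove[OF fin(2) \<open>y \<in> R\<close>] by simp
      have "card (E \<inter> S \<times> R) = card (E\<inverse> `` {y} \<inter> S) + card (E \<inter> S \<times> (R - {y}))"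
        using \<open>y \<in> R\<close> fin by (simp add: e_converse sum.remove)
      then show ?thesis using worse[of S "R - {y}"] S R c unfolding excess_def
        by (auto simp: algebra_simps)
    qed
    show "t \<le> card (E `` {x} \<inter> (Y - (Y - R)))" if "x \<in> X - S" for x
    proof (rule ccontr)
      assume "\<not> ?thesis"
      then have less: "card (E `` {x} \<inter> R) < t" unfolding R' by simp
      have c: "card (insert x S) = Suc (card S)" using that fin by simp
      have "card (E \<inter> insert x S \<times> R) = card (E `` {x} \<inter> R) + card (E \<inter> S \<times> R)"
        using that fin by (simp add: e_Image)
      \<comment> \<open>The gain of at least \<open>K\<close> outweighs the tie-break loss of 1,
        since \<open>K > 1\<close>.\<close>
      then have "excess S R + 1 \<le> excess (insert x S) R"
        using less c unfolding excess_def by (simp add: algebra_simps)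
      then have "K * (excess S R + 1) \<le> K * excess (insert x S) R"
        unfolding K_def by (intro mult_left_mono) auto
      moreover have "card X > 0" using that finite_X by (auto simp: card_gt_0_iff)
      then have "K > 1" unfolding K_def by simp
      ultimately have "w (insert x S, R) > w (S, R)"
        using c unfolding w_def by (simp add: distrib_left)
      then show False using max[of "insert x S" R] that S R by auto
    qed
  qed (use S R in auto)
  then show False using lt by simp
qed

end

section \<open>Translation between graphs and edge sets\<close>

lemma degree_eq_card_Image: "degree G v = card (parcs G `` {v})"
proof -
  have "out_arcs (with_proj G) v = Pair v ` (parcs G `` {v})" by (auto simp: out_arcs_def)
  then show ?thesis by (simp add: out_degree_def card_image inj_on_def)
qed

text \<open>Here \<open>a\<close> and \<open>b\<close> enumerate the leaves from 1 on, and the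
  update at 0 places the centres; \<open>f\<close> is the embedding of the double star.\<close>

lemma double_star_arcs_image:
  fixes a b :: "nat \<Rightarrow> 'a" and x y :: 'a
  assumes "a ` {1..k} = A" "b ` {1..l} = B"
  defines "f \<equiv> case_sum (a(0 := x)) (b(0 := y))"
  shows "f ` pverts (double_star k l) = insert x A \<union> insert y B"
    and "map_prod f f ` parcs (double_star k l) =
      {x} \<times> A \<union> A \<times> {x} \<union> {y} \<times> B \<union> B \<times> {y} \<union> {(x, y), (y, x)}"
proof -
  have "{0..k} = insert 0 {1..k}" "{0..l} = insert 0 {1..l}" by auto
  moreover have im: "(a(0 := x)) ` {1..k} = A" "(b(0 := y)) ` {1..l} = B" using assms(1,2) by auto
  ultimately show "f ` pverts (double_star k l) = insert x A \<union> insert y B"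
    by (simp add: f_def double_star_def star_def Plus_def image_Un image_image)
  show "map_prod f f ` parcs (double_star k l) =
      {x} \<times> A \<union> A \<times> {x} \<union> {y} \<times> B \<union> B \<times> {y} \<union> {(x, y), (y, x)}"
    unfolding double_star_def star_def
    by (simp add: image_Un image_paired_Times map_prod_def f_def image_image im insert_commute
          del: fun_upd_apply) (use assms(1,2) in \<open>simp add: Un_assoc\<close>)
qed

lemma inj_on_case_sum_Plus:
  assumes "inj_on u A" "inj_on v B" "u ` A \<inter> v ` B = {}"
  shows "inj_on (case_sum u v) (A <+> B)"
proof (rule inj_onI)
  fix i j assume ij: "i \<in> A <+> B" "j \<in> A <+> B" and eq: "case_sum u v i = case_sum u v j"
  have "u a \<noteq> v b" "v b \<noteq> u a" if "a \<in> A" "b \<in> B" for a b using assms(3) that by auto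
  then show "i = j"
    using ij eq assms(1,2) by (cases i; cases j) (auto dest: inj_onD)
qed

text \<open>Bipartiteness excludes edges inside \<open>insert x B\<close> and inside
  \<open>insert y A\<close>, and \<open>AB\<close> excludes those between leaves of different
  centres. Only the edges of the double star are left.\<close>

lemma not_induced_free_double_star:
  assumes "pair_graph G" "bipartition G X Y" "x \<in> X" "y \<in> Y" "(x, y) \<in> parcs G"
    and A: "A \<subseteq> parcs G `` {x}" "card A = k" "y \<notin> A"
    and B: "B \<subseteq> parcs G `` {y}" "card B = l" "x \<notin> B"
    and AB: "parcs G \<inter> B \<times> A = {}"
  shows "\<not> induced_free (double_star k l) G"
proof -
  interpret pair_graph G by fact
  have sym: "(u, v) \<in> parcs G \<longleftrightarrow> (v, u) \<in> parcs G" for u v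
    using arcs_symmetric by blast
  have G: "pverts G = X \<union> Y" "X \<inter> Y = {}" "parcs G \<subseteq> X \<times> Y \<union> Y \<times> X"
    using assms(2) unfolding bipartition_def by simp_all
  have "A \<subseteq> Y" using A(1) G(2,3) assms(3) by blast
  moreover have "B \<subseteq> X" using B(1) G(2,3) assms(4) by blast
  ultimately have sub: "A \<subseteq> Y" "B \<subseteq> X" .
  have "finite X" "finite Y" using pair_finite_verts G(1) by simp_all
  then have fin: "finite A" "finite B" using sub finite_subset by blast+
  obtain a where a: "bij_betw a {1..k} A" using ex_bij_betw_nat_finite_1[OF fin(1)] A(2) by auto
  obtain b where b: "bij_betw b {1..l} B" using ex_bij_betw_nat_finite_1[OF fin(2)] B(2) by auto
  define f where "f = case_sum (a(0 := x)) (b(0 := y))"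
  let ?D = "double_star k l"
  define H where "H = \<lparr> pverts = f ` pverts ?D, parcs = map_prod f f ` parcs ?D \<rparr>"
  define iso where "iso = \<lparr> iso_verts = f, iso_arcs = map_prod f f, iso_head = snd, iso_tail = fst \<rparr>"
  interpret D: pair_graph ?D by (rule pair_graph_double_star)
  have im: "a ` {1..k} = A" "b ` {1..l} = B" using a b by (auto simp: bij_betw_def)
  have H: "pverts H = insert x A \<union> insert y B"
    "parcs H = {x} \<times> A \<union> A \<times> {x} \<union> {y} \<times> B \<union> B \<times> {y} \<union> {(x, y), (y, x)}"
    unfolding H_def f_def using double_star_arcs_image[OF im, of x y] by simp_all
  have disj: "insert x A \<inter> insert y B = {}" using sub G(2) A(3) B(3) assms(3,4) by blast
  have "x \<notin> A" "y \<notin> B" using sub G(2) assms(3,4) by blast+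
  have eq: "{0..n} = insert 0 {1..n}" for n :: nat by auto
  have im0: "(a(0 := x)) ` {1..k} = A" "(b(0 := y)) ` {1..l} = B" using im by auto
  have "inj_on (a(0 := x)) {1..k}" "inj_on (b(0 := y)) {1..l}"
    using a b \<open>x \<notin> A\<close> \<open>y \<notin> B\<close> im by (auto simp: bij_betw_def intro: inj_on_fun_updI)
  then have "inj_on (a(0 := x)) {0..k}" "inj_on (b(0 := y)) {0..l}"
    unfolding eq inj_on_insert using \<open>x \<notin> A\<close> \<open>y \<notin> B\<close> im0 by auto
  moreover have "(a(0 := x)) ` {0..k} \<inter> (b(0 := y)) ` {0..l} = {}"
    unfolding eq image_insert im0 using disj by simp
  ultimately have inj: "inj_on f (pverts ?D)"
    unfolding f_def double_star_def star_def by (simp add: inj_on_case_sum_Plus del: fun_upd_apply)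
  have "inj_on (map_prod f f) (pverts ?D \<times> pverts ?D)" by (rule map_prod_inj_on[OF inj inj])
  moreover have "parcs ?D \<subseteq> pverts ?D \<times> pverts ?D" using D.wellformed' by auto
  ultimately have "inj_on (map_prod f f) (parcs ?D)" by (rule inj_on_subset)
  then have iso: "pre_digraph.digraph_isomorphism ?D iso"
    using inj by (simp add: D.digraph_isomorphism_def iso_def D.wf_digraph_axioms)
  have HD: "with_proj H = app_iso iso (with_proj ?D)"
    by (intro pre_digraph.equality) (simp_all add: H_def iso_def)
  \<comment> \<open>The embedding goes from the double star to \<open>H\<close>, so the inverse
    isomorphism is taken.\<close>
  have "digraph_iso H ?D"
    unfolding digraph_iso_def HD
    using pre_digraph.app_iso_inv[OF iso] wf_digraph.digraph_isomorphism_invI[OF D.wf_digraph_axioms iso]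
    by metis
  moreover have "induced_subgraph H G"
  proof -
    have "parcs H = parcs G \<inter> pverts H \<times> pverts H"
    proof
      show "parcs H \<subseteq> parcs G \<inter> pverts H \<times> pverts H"
        unfolding H using A(1) B(1) assms(5) sym by auto
      have arc: "(u, v) \<in> parcs H \<and> (v, u) \<in> parcs H"
        if "(u, v) \<in> parcs G" "u \<in> pverts H" "v \<in> pverts H" "u \<in> X" "v \<in> Y" for u v
      proof -
        have "u = x \<or> u \<in> B" using that(2,4) sub G(2) assms(4) unfolding H by blast
        moreover have "v = y \<or> v \<in> A" using that(3,5) sub G(2) assms(3) unfolding H by blast
        moreover have "\<not> (u \<in> B \<and> v \<in> A)" using that(1) AB by blast
        ultimately show ?thesis unfolding H by auto
      qed
      show "parcs G \<inter> pverts H \<times> pverts H \<subseteq> parcs H"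
      proof (rule subrelI)
        fix u v assume uv: "(u, v) \<in> parcs G \<inter> pverts H \<times> pverts H"
        then consider "u \<in> X" "v \<in> Y" | "u \<in> Y" "v \<in> X" using G(3) by blast
        then show "(u, v) \<in> parcs H"
          using uv arc[of u v] arc[of v u] sym by cases auto
      qed
    qed
    moreover have "pverts H \<subseteq> pverts G" unfolding H using sub G assms(3,4) by auto
    ultimately show ?thesis
      unfolding induced_subgraph_def subgraph_def
      by (auto simp: wf_digraph_axioms wf_digraph_def)
  qed
  ultimately show ?thesis unfolding induced_free_def by blast
qed

text \<open>The arcs from \<open>X\<close> to \<open>Y\<close> form the edge set \<open>E\<close> of
  the locale; the regular subset \<open>F\<close> found there becomes a factor after adding the
  reversed arcs.\<close>

lemma ex_factor:
  assumes "pair_graph G" "bipartition G X Y" "balanced G" "induced_free (double_star k l) G"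
    and t: "k \<le> t" "l \<le> t" "m \<le> t" "1 \<le> t"
    and deg: "\<And>v. v \<in> pverts G \<Longrightarrow> 2 * t^2 \<le> degree G v"
  shows "\<exists>H. is_factor m H G"
proof -
  interpret pair_graph G by fact
  have sym: "(u, v) \<in> parcs G \<longleftrightarrow> (v, u) \<in> parcs G" for u v
    using arcs_symmetric by blast
  have G: "pverts G = X \<union> Y" "X \<inter> Y = {}" "parcs G \<subseteq> X \<times> Y \<union> Y \<times> X"
    using assms(2) unfolding bipartition_def by simp_all
  have fin: "finite X" "finite Y" using pair_finite_verts G(1) by simp_all
  have card_eq: "card X = card Y" using assms(2,3) unfolding balanced_def by blast
  define E where "E = parcs G \<inter> X \<times> Y"
  have E_X: "E `` {x} = parcs G `` {x}" if "x \<in> X" for x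
    using that G(2,3) unfolding E_def by blast
  have E_Y: "E\<inverse> `` {y} = parcs G `` {y}" if "y \<in> Y" for y
    using that G(2,3) sym unfolding E_def by blast
  interpret E: dense_double_star_free E X Y t
  proof
    show "2 * t^2 \<le> card (E `` {x})" if "x \<in> X" for x
      using deg[of x] that G(1) E_X[OF that] by (simp add: degree_eq_card_Image)
    show "2 * t^2 \<le> card (E\<inverse> `` {y})" if "y \<in> Y" for y
      using deg[of y] that G(1) E_Y[OF that] by (simp add: degree_eq_card_Image)
    fix x y P Q
    assume xy: "(x, y) \<in> E" and PQ: "E \<inter> P \<times> Q = {}" and x_deg: "t \<le> card (E `` {x} \<inter> Q)"
    have "x \<in> X" "y \<in> Y" "(x, y) \<in> parcs G" using xy unfolding E_def by auto
    show "card (E\<inverse> `` {y} \<inter> P) < t"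
    proof (rule ccontr)
      assume "\<not> ?thesis"
      then have y_deg: "t \<le> card (E\<inverse> `` {y} \<inter> P)" by simp
      obtain A where A: "A \<subseteq> E `` {x} \<inter> Q" "card A = k"
        using x_deg t(1) by (meson le_trans obtain_subset_with_card_n)
      obtain B where B: "B \<subseteq> E\<inverse> `` {y} \<inter> P" "card B = l"
        using y_deg t(2) by (meson le_trans obtain_subset_with_card_n)
      \<comment> \<open>If \<open>y\<close> were in \<open>Q\<close>, a neighbour of
        \<open>y\<close> in \<open>P\<close> would give an edge between \<open>P\<close> and
        \<open>Q\<close>; likewise if \<open>x\<close> were in \<open>P\<close>. Hence the centres
        do not occur among the leaves.\<close>
      have "E `` {x} \<inter> Q \<noteq> {}" "E\<inverse> `` {y} \<inter> P \<noteq> {}" using x_deg y_deg t(4) by auto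
      then have "x \<notin> P" "y \<notin> Q" using PQ by blast+
      have AB: "A \<subseteq> Y" "B \<subseteq> X" using A B unfolding E_def by auto
      have "parcs G \<inter> B \<times> A \<subseteq> E" unfolding E_def using AB by auto
      then have "parcs G \<inter> B \<times> A = {}" using PQ A(1) B(1) by blast
      moreover have "A \<subseteq> parcs G `` {x}" using A(1) E_X[OF \<open>x \<in> X\<close>] by auto
      moreover have "B \<subseteq> parcs G `` {y}" using B(1) E_Y[OF \<open>y \<in> Y\<close>] by auto
      moreover have "y \<notin> A" "x \<notin> B" using A(1) B(1) \<open>x \<notin> P\<close> \<open>y \<notin> Q\<close> by auto
      ultimately show False
        using not_induced_free_double_star[OF assms(1,2) \<open>x \<in> X\<close> \<open>y \<in> Y\<close> \<open>(x, y) \<in> parcs G\<close>,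
            of A k B l] A(2) B(2) assms(4) by blast
    qed
  next
    fix P Q assume PQ: "P \<subseteq> X" "Q \<subseteq> Y" "E `` P \<subseteq> Q" "E\<inverse> `` Q \<subseteq> P"
    \<comment> \<open>Exchanging the sides on \<open>P \<union> Q\<close>, which no edge leaves, yields another bipartition.\<close>
    have edge: "u \<in> P \<longleftrightarrow> v \<in> Q" if "(u, v) \<in> parcs G" "u \<in> X" "v \<in> Y" for u v
      using that PQ(3,4) unfolding E_def by blast
    have "bipartition G ((X - P) \<union> Q) ((Y - Q) \<union> P)"
      unfolding bipartition_def
    proof (intro conjI)
      show "pverts G = (X - P) \<union> Q \<union> ((Y - Q) \<union> P)" using G(1) PQ(1,2) by auto
      show "((X - P) \<union> Q) \<inter> ((Y - Q) \<union> P) = {}" using G(2) PQ(1,2) by auto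
      show "parcs G \<subseteq> ((X - P) \<union> Q) \<times> ((Y - Q) \<union> P) \<union> ((Y - Q) \<union> P) \<times> ((X - P) \<union> Q)"
      proof (rule subrelI)
        fix u v assume uv: "(u, v) \<in> parcs G"
        then consider "u \<in> X" "v \<in> Y" | "u \<in> Y" "v \<in> X" using G(3) by blast
        then show "(u, v) \<in> ((X - P) \<union> Q) \<times> ((Y - Q) \<union> P) \<union> ((Y - Q) \<union> P) \<times> ((X - P) \<union> Q)"
        proof cases
          case 1
          then show ?thesis using edge[OF uv] by blast
        next
          case 2
          then show ?thesis using edge[of v u] uv sym by blast
        qed
      qed
    qed
    \<comment> \<open>Compared with \<open>card X = card Y\<close>, balance of the exchanged
      bipartition gives \<open>2 * card P = 2 * card Q\<close>.\<close>
    then have "card ((X - P) \<union> Q) = card ((Y - Q) \<union> P)" using assms(3) unfolding balanced_def by blast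
    moreover have "finite P" "finite Q" using PQ(1,2) fin finite_subset by blast+
    moreover have "(X - P) \<inter> Q = {}" "(Y - Q) \<inter> P = {}" using PQ(1,2) G(2) by blast+
    ultimately have "card (X - P) + card Q = card (Y - Q) + card P"
      using fin by (simp add: card_Un_disjoint)
    moreover have "card X = card (X - P) + card P" "card Y = card (Y - Q) + card Q"
      using PQ(1,2) fin \<open>finite P\<close> \<open>finite Q\<close> by (simp_all add: card_Diff_subset card_mono)
    ultimately show "card P = card Q" using card_eq by linarith
  qed (use fin t(4) E_def in auto)
  obtain F where F: "F \<subseteq> E" "\<And>x. x \<in> X \<Longrightarrow> card (F `` {x}) = m" "\<And>y. y \<in> Y \<Longrightarrow> card (F\<inverse> `` {y}) = m"
    using ex_regular_subset[OF fin E.E_subset card_eq E.factor_condition[OF t(3)]] by blast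
  have FG: "F \<subseteq> X \<times> Y" "F \<subseteq> parcs G" "F\<inverse> \<subseteq> parcs G" using F(1) sym unfolding E_def by auto
  define H where "H = \<lparr> pverts = pverts G, parcs = F \<union> F\<inverse> \<rparr>"
  have H: "pair_graph H"
  proof
    show "symmetric (with_proj H)" by (auto simp: symmetric_def sym_def H_def)
    show "finite (pverts H)" by (simp add: H_def pair_finite_verts)
    show "finite (parcs H)" using FG finite_subset[OF _ pair_finite_arcs] by (simp add: H_def)
    fix e assume "e \<in> parcs H"
    then have "e \<in> parcs G" using FG(2,3) by (auto simp: H_def)
    then show "fst e \<in> pverts H" "snd e \<in> pverts H" "fst e \<noteq> snd e"
      using arc_fst_in_verts arc_snd_in_verts pair_no_loops by (simp_all add: H_def)
  qed
  interpret H: pair_graph H by (rule H)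
  have "spanning (with_proj H) (with_proj G)"
    unfolding spanning_def subgraph_def
    using FG(2,3) wf_digraph_axioms H.wf_digraph_axioms by (auto simp: H_def)
  moreover have "degree H v = m" if "v \<in> pverts H" for v
  proof (cases "v \<in> X")
    case True
    then have "(F \<union> F\<inverse>) `` {v} = F `` {v}" using FG(1) G(2) by blast
    then show ?thesis using F(2)[OF True] by (simp add: degree_eq_card_Image H_def)
  next
    case False
    then have "v \<in> Y" using that G(1) by (simp add: H_def)
    have "(F \<union> F\<inverse>) `` {v} = F\<inverse> `` {v}" using False FG(1) by blast
    then show ?thesis using F(3)[OF \<open>v \<in> Y\<close>] by (simp add: degree_eq_card_Image H_def)
  qed
  ultimately show ?thesis using H unfolding is_factor_def by blast
qed

theorem theorem2:
  fixes k l m :: nat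
  assumes "k \<ge> 1" and "l \<ge> 1" and "m \<ge> 1"
  shows "(\<exists>c'::nat. \<forall>G :: 'a pair_pre_digraph.
            pair_graph G \<and> bipartite G \<and> balanced G \<and> induced_free (double_star k l) G
              \<and> min_degree G \<ge> c' \<longrightarrow> (\<exists>H. is_factor m H G))
       \<and> (\<forall>G :: 'a pair_pre_digraph.
            pair_graph G \<and> bipartite G \<and> balanced G \<and> induced_free (double_star k l) G
              \<and> min_degree G \<ge> 2 * (Max {k, l, m})^2 \<longrightarrow> (\<exists>H. is_factor m H G))"
proof -
  define t where "t = Max {k, l, m}"
  have t: "k \<le> t" "l \<le> t" "m \<le> t" unfolding t_def by auto
  have "\<exists>H. is_factor m H G"
    if G: "pair_graph G" "bipartite G" "balanced G" "induced_free (double_star k l) G"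
      and min: "2 * t^2 \<le> min_degree G" for G :: "'a pair_pre_digraph"
  proof -
    obtain X Y where XY: "bipartition G X Y" using G(2) unfolding bipartite_def by blast
    interpret pair_graph G by fact
    show ?thesis
    proof (rule ex_factor[OF G(1) XY G(3,4) t])
      show "1 \<le> t" using t assms(1) by linarith
      show "2 * t^2 \<le> degree G v" if "v \<in> pverts G" for v
      proof -
        have "min_degree G \<le> degree G v"
          unfolding min_degree_def using pair_finite_verts that by (intro Min_le) auto
        then show ?thesis using min by linarith
      qed
    qed
  qed
  then show ?thesis unfolding t_def by blast
qed

end
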